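(* Let $x_1,\dots,x_{2m}$ be indeterminates over $\mathbb{Z}$ with $m\geqslant3$, and set $R=\mathbb{Z}[x_1,\dots,x_{2m}]/\big(\sum_{i=1}^mx_ix_{m+i}\big)$. Then for each prime integer $p>0$, the Frobenius trace on $R/pR$ does not lift to a differential operator on $R/p^2R$, nor, a fortiori, to a differential operator on $R$.
   Context: Differential operators on a commutative ring are in Grothendieck's sense (additive maps such that, inductively, commutators with multiplication maps have lower order). A differential operator on $R/pR$ lifts to $R/p^2R$ (resp. $R$) if it is induced modulo $p$ by a differential operator on $R/p^2R$ (resp. $R$). Frobenius trace: for a field $K$ of characteristic $p$, $S=K[x_1,\dots,x_N]$ and $g\in S$ nonzero homogeneous, let $\partial_a$ be the $K$-linear map $x^b\mapsto\prod\binom{b_i}{a_i}x^{b-a}$ and $\Phi_S=\partial_{p-1,\dots,p-1}$ (mapping $S$ into $S^p$); the composite $S\xrightarrow{g^{p-1}}S\xrightarrow{\Phi_S}S^p\to(S/(g))^p$ kills $gS$, and the induced map $S/(g)\to(S/(g))^p$ is the Frobenius trace of $S/(g)$. It is applied to $R/pR$ over $K=\mathbb{Z}/p\mathbb{Z}$. *)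

theory Defs
  imports "HOL-Library.Poly_Mapping" "HOL-Computational_Algebra.Primes"
begin

text \<open>Polynomials over the integers in variables indexed by nat:
  a polynomial is a finitely supported map from monomials (exponent vectors,
  finitely supported maps nat to nat) to integer coefficients; multiplication
  is convolution.  Variable x_(i+1) of the paper is X i.\<close>

type_synonym mpoly = "(nat \<Rightarrow>\<^sub>0 nat) \<Rightarrow>\<^sub>0 int"

definition X :: "nat \<Rightarrow> mpoly" where
  "X i = Poly_Mapping.single (Poly_Mapping.single i 1) 1"

definition const :: "int \<Rightarrow> mpoly" where
  "const c = Poly_Mapping.single 0 c"

definition Polys :: "nat \<Rightarrow> mpoly set" where
  "Polys N = {P::mpoly. \<forall>t\<in>Poly_Mapping.keys P. Poly_Mapping.keys t \<subseteq> {..<N}}"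

definition quad :: "nat \<Rightarrow> mpoly" where
  "quad m = (\<Sum>i<m. X i * X (m + i))"

text \<open>Congruence in the quotient ring Z[x_1..x_N]/(q, g):
  a - b lies in the ideal generated by the integer q and the polynomial g.
  q = p^k gives R/p^k R for R = Z[x]/(g); q = 0 gives R itself.\<close>
definition cong_mod :: "nat \<Rightarrow> int \<Rightarrow> mpoly \<Rightarrow> mpoly \<Rightarrow> mpoly \<Rightarrow> bool" where
  "cong_mod N q g a b \<longleftrightarrow>
     (\<exists>u\<in>Polys N. \<exists>v\<in>Polys N. a - b = const q * u + g * v)"

text \<open>A map D on representatives induces a well-defined additive map on the
  quotient ring A = Z[x_1..x_N]/(q, g).\<close>
definition additive_on_quot :: "nat \<Rightarrow> int \<Rightarrow> mpoly \<Rightarrow> (mpoly \<Rightarrow> mpoly) \<Rightarrow> bool" where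
  "additive_on_quot N q g D \<longleftrightarrow>
     (\<forall>a\<in>Polys N. D a \<in> Polys N) \<and>
     (\<forall>a\<in>Polys N. \<forall>b\<in>Polys N. cong_mod N q g a b \<longrightarrow> cong_mod N q g (D a) (D b)) \<and>
     (\<forall>a\<in>Polys N. \<forall>b\<in>Polys N. cong_mod N q g (D (a + b)) (D a + D b))"

fun diffop_ord :: "nat \<Rightarrow> int \<Rightarrow> mpoly \<Rightarrow> nat \<Rightarrow> (mpoly \<Rightarrow> mpoly) \<Rightarrow> bool" where
  "diffop_ord N q g 0 D \<longleftrightarrow>
     additive_on_quot N q g D \<and>
     (\<forall>r\<in>Polys N. \<forall>a\<in>Polys N. cong_mod N q g (D (r * a)) (r * D a))"
| "diffop_ord N q g (Suc n) D \<longleftrightarrow>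
     additive_on_quot N q g D \<and>
     (\<forall>r\<in>Polys N. diffop_ord N q g n (\<lambda>a. D (r * a) - r * D a))"

definition is_diffop :: "nat \<Rightarrow> int \<Rightarrow> mpoly \<Rightarrow> (mpoly \<Rightarrow> mpoly) \<Rightarrow> bool" where
  "is_diffop N q g D \<longleftrightarrow> (\<exists>n. diffop_ord N q g n D)"

text \<open>The operator partial_a : x^b \<mapsto> prod_i (b_i choose a_i) x^(b-a)
  (zero when some a_i > b_i, since then a binomial coefficient vanishes).\<close>
definition hasse :: "(nat \<Rightarrow>\<^sub>0 nat) \<Rightarrow> mpoly \<Rightarrow> mpoly" where
  "hasse a P = (\<Sum>t\<in>Poly_Mapping.keys P. Poly_Mapping.single (t - a)
       (Poly_Mapping.lookup P t * (\<Prod>i\<in>Poly_Mapping.keys a. int (Poly_Mapping.lookup t i choose Poly_Mapping.lookup a i))))"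

text \<open>Frobenius trace of S/(g), S = F_p[x_1..x_N], computed on integer
  representatives: a \<mapsto> partial_(p-1,...,p-1) (g^(p-1) a), read modulo (p, g).
  (Its values lie in (S/(g))^p, viewed inside S/(g).)\<close>
definition frob_trace :: "nat \<Rightarrow> nat \<Rightarrow> mpoly \<Rightarrow> mpoly \<Rightarrow> mpoly" where
  "frob_trace N p g a = hasse (\<Sum>i<N. Poly_Mapping.single i (p - 1)) (g ^ (p - 1) * a)"

definition lifts_to :: "nat \<Rightarrow> nat \<Rightarrow> int \<Rightarrow> mpoly \<Rightarrow> (mpoly \<Rightarrow> mpoly) \<Rightarrow> bool" where
  "lifts_to N p q g \<Phi> \<longleftrightarrow>
     (\<exists>D. is_diffop N q g D \<and> (\<forall>a\<in>Polys N. cong_mod N (int p) g (D a) (\<Phi> a)))"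

end

theory Submission
  imports Defs
begin

text \<open>Write y_i for X (m + i), z_i = x_i y_i and f for the sum of the z_i. Suppose that D, of order
  n, lifts the Frobenius trace. If Q is a high power of p, then D commutes with all Q-th powers
  modulo p^2, so D maps multiples of x_i^Q to multiples of x_i^Q modulo (p^2, f). Let M be the
  product of x^(Q-p) (all x_i) and the monomial in the z_i with exponents
  (p-2, 0, 0, p-1, ..., p-1). Expanding f^p as the sum of the z_i^p plus p W, we have
  D (M f^p) = 0, and M z_i^p is a multiple of x_i^Q. Since f vanishes at y = 0, it makes sense to
  extract the coefficient of x^(Q-p) y^0: p divides that coefficient of D (M W), hence that of the
  Frobenius trace of M W. Up to a unit modulo p the latter is the coefficient of
  z_1 z_2^(p-1) z_3^(p-1) in f^(p-1) W, and p times it is the multinomial coefficient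
  (2p-1)! / (p-1)!^2 of f^(2p-1), which is not divisible by p^2.\<close>

section \<open>Polynomials and their coefficients\<close>

lemma lookup_single_mult_add:
  fixes P :: mpoly
  shows "Poly_Mapping.lookup (Poly_Mapping.single s c * P) (s + t) = c * Poly_Mapping.lookup P t"
  by (simp add: lookup_mult lookup_single when_mult when_def[of _ "_ = _ + _"])

lemma lookup_single_mult_eq_0:
  fixes P :: mpoly
  assumes "\<And>u. t \<noteq> s + u"
  shows "Poly_Mapping.lookup (Poly_Mapping.single s c * P) t = 0"
  using assms by (simp add: lookup_mult lookup_single when_mult)

lemma lookup_const_mult:
  "Poly_Mapping.lookup (const c * P) t = c * Poly_Mapping.lookup P t"
  using lookup_single_mult_add[of 0 c P t] by (simp add: const_def)

lemma X_power: "X j ^ k = Poly_Mapping.single (Poly_Mapping.single j k) 1"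
  by (induction k) (simp_all add: X_def mult_single flip: single_add)

lemma lookup_X_power_mult_eq_0:
  assumes "Poly_Mapping.lookup t j < k"
  shows "Poly_Mapping.lookup (X j ^ k * P) t = 0"
  unfolding X_power by (rule lookup_single_mult_eq_0) (use assms in \<open>auto simp: lookup_add\<close>)

lemma const_of_nat: "const (int n) = of_nat n"
  by (simp add: const_def)

lemma const_mult: "const a * const b = const (a * b)"
  by (simp add: const_def mult_single)

section \<open>The ring of polynomials in the first N variables\<close>

lemma Polys_single: "Poly_Mapping.keys t \<subseteq> {..<N} \<Longrightarrow> Poly_Mapping.single t c \<in> Polys N"
  by (auto simp: Polys_def split: if_splits)

lemma Polys_X: "i < N \<Longrightarrow> X i \<in> Polys N"
  unfolding X_def by (rule Polys_single) simp

lemma Polys_const: "const c \<in> Polys N"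
  unfolding const_def by (rule Polys_single) simp

lemma Polys_0: "0 \<in> Polys N"
  by (simp add: Polys_def)

lemma Polys_1: "1 \<in> Polys N"
  by (simp add: Polys_def)

lemma Polys_uminus: "a \<in> Polys N \<Longrightarrow> - a \<in> Polys N"
  by (simp add: Polys_def)

lemma Polys_add: "a \<in> Polys N \<Longrightarrow> b \<in> Polys N \<Longrightarrow> a + b \<in> Polys N"
  using keys_add[of a b] by (auto simp: Polys_def)

lemma Polys_diff: "a \<in> Polys N \<Longrightarrow> b \<in> Polys N \<Longrightarrow> a - b \<in> Polys N"
  using Polys_add[of a N "- b"] by (simp add: Polys_uminus)

lemma Polys_mult:
  assumes "a \<in> Polys N" "b \<in> Polys N"
  shows "a * b \<in> Polys N"
  unfolding Polys_def
proof (intro CollectI ballI)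
  fix t assume "t \<in> Poly_Mapping.keys (a * b)"
  then obtain u v where "t = u + v" "u \<in> Poly_Mapping.keys a" "v \<in> Poly_Mapping.keys b"
    using keys_mult[of a b] by blast
  then show "Poly_Mapping.keys t \<subseteq> {..<N}"
    using assms keys_add[of u v] by (fastforce simp: Polys_def)
qed

lemma Polys_power: "a \<in> Polys N \<Longrightarrow> a ^ n \<in> Polys N"
  by (induction n) (auto intro: Polys_mult Polys_1)

lemma Polys_sum: "(\<And>i. i \<in> I \<Longrightarrow> F i \<in> Polys N) \<Longrightarrow> sum F I \<in> Polys N"
  by (induction I rule: infinite_finite_induct) (auto intro: Polys_0 Polys_add)

lemmas Polys_intros = Polys_X Polys_const Polys_0 Polys_1 Polys_add Polys_diff Polys_mult
  Polys_power Polys_sum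

lemma Polys_quad: "quad m \<in> Polys (2 * m)"
  unfolding quad_def by (intro Polys_intros) auto

text \<open>p divides the inner binomial coefficients, so their quotients by p give an integral
  error term W. The identity is kept exact rather than modulo p because a coefficient of W carries
  the obstruction to lifting.\<close>

lemma freshmans_dream_add:
  assumes p: "prime p" and a: "a \<in> Polys N" and b: "b \<in> Polys N"
  shows "\<exists>W\<in>Polys N. (a + b) ^ p = a ^ p + b ^ p + const (int p) * W"
proof -
  have p1: "1 < p" using p prime_gt_1_nat by blast
  let ?c = "\<lambda>k. (p choose k) div p"
  define W where "W = (\<Sum>k\<in>{0<..<p}. const (int (?c k)) * (a ^ k * b ^ (p - k)))"
  have "(a + b) ^ p = (\<Sum>k\<le>p. of_nat (p choose k) * a ^ k * b ^ (p - k))"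
    by (rule binomial_ring)
  also have "{..p} = insert 0 (insert p {0<..<p})"
    using p1 by auto
  also have "(\<Sum>k\<in>\<dots>. of_nat (p choose k) * a ^ k * b ^ (p - k)) =
      b ^ p + (a ^ p + (\<Sum>k\<in>{0<..<p}. of_nat (p choose k) * a ^ k * b ^ (p - k)))"
    using p1 by simp
  also have "(\<Sum>k\<in>{0<..<p}. of_nat (p choose k) * a ^ k * b ^ (p - k)) = const (int p) * W"
    unfolding W_def sum_distrib_left
  proof (rule sum.cong)
    fix k assume "k \<in> {0<..<p}"
    then have "p dvd (p choose k)"
      by (intro dvd_choose_prime) (use p in auto)
    then have "of_nat (p choose k) = const (int p) * const (int (?c k))"
      by (simp add: const_of_nat flip: of_nat_mult)
    then show "of_nat (p choose k) * a ^ k * b ^ (p - k) =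
        const (int p) * (const (int (?c k)) * (a ^ k * b ^ (p - k)))"
      by (simp only: mult.assoc)
  qed simp
  finally have "(a + b) ^ p = a ^ p + b ^ p + const (int p) * W"
    by (simp only: add_ac)
  moreover have "W \<in> Polys N"
    unfolding W_def using a b by (intro Polys_intros)
  ultimately show ?thesis by blast
qed

lemma freshmans_dream_sum:
  assumes p: "prime p" and "finite I" and "\<And>i. i \<in> I \<Longrightarrow> F i \<in> Polys N"
  shows "\<exists>W\<in>Polys N. (\<Sum>i\<in>I. F i) ^ p = (\<Sum>i\<in>I. F i ^ p) + const (int p) * W"
  using assms(2,3)
proof (induction I rule: finite_induct)
  case empty
  then show ?case using p Polys_0 by (intro bexI[of _ 0]) (auto simp: prime_gt_0_nat)
next
  case (insert i I)
  then obtain W where W: "W \<in> Polys N" "(\<Sum>i\<in>I. F i) ^ p = (\<Sum>i\<in>I. F i ^ p) + const (int p) * W"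
    by auto
  obtain V where V: "V \<in> Polys N"
    "(F i + sum F I) ^ p = F i ^ p + sum F I ^ p + const (int p) * V"
    using freshmans_dream_add[OF p, of "F i" N "sum F I"] insert.prems
    by (auto intro: Polys_sum)
  have "(\<Sum>i\<in>insert i I. F i) ^ p = (\<Sum>i\<in>insert i I. F i ^ p) + const (int p) * (W + V)"
    using insert.hyps V(2) W(2) by (simp add: algebra_simps)
  then show ?case using W(1) V(1) Polys_add by blast
qed

section \<open>Congruences and differential operators\<close>

lemma cong_mod_refl: "cong_mod N q g a a"
  unfolding cong_mod_def using Polys_0 by force

lemma cong_mod_add:
  assumes "cong_mod N q g a b" "cong_mod N q g c d"
  shows "cong_mod N q g (a + c) (b + d)"
proof -
  obtain u v u' v' where "u \<in> Polys N" "v \<in> Polys N" "u' \<in> Polys N" "v' \<in> Polys N"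
    "a - b = const q * u + g * v" "c - d = const q * u' + g * v'"
    using assms unfolding cong_mod_def by blast
  moreover from this have "(a + c) - (b + d) = const q * (u + u') + g * (v + v')"
    by (simp add: algebra_simps)
  ultimately show ?thesis
    unfolding cong_mod_def using Polys_add by blast
qed

lemma cong_mod_trans [trans]:
  assumes "cong_mod N q g a b" "cong_mod N q g b c"
  shows "cong_mod N q g a c"
  \<comment> \<open>Adding the two congruences compares a + b with b + c, and b cancels in the
    difference.\<close>
  using cong_mod_add[OF assms] by (simp add: cong_mod_def)

lemma cong_mod_mult_left:
  assumes "cong_mod N q g a b" and r: "r \<in> Polys N"
  shows "cong_mod N q g (r * a) (r * b)"
proof -
  obtain u v where uv: "u \<in> Polys N" "v \<in> Polys N" "a - b = const q * u + g * v"
    using assms unfolding cong_mod_def by blast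
  have "r * a - r * b = r * (a - b)"
    by (simp add: algebra_simps)
  also have "\<dots> = const q * (r * u) + g * (r * v)"
    unfolding uv(3) by (simp add: algebra_simps)
  finally show ?thesis
    unfolding cong_mod_def using uv r Polys_mult by blast
qed

lemma cong_mod_dvd:
  assumes "cong_mod N q g a b" "k dvd q"
  shows "cong_mod N k g a b"
proof -
  obtain u v where uv: "u \<in> Polys N" "v \<in> Polys N" "a - b = const q * u + g * v"
    using assms unfolding cong_mod_def by blast
  obtain l where "q = k * l" using assms(2) by blast
  then have "a - b = const k * (const l * u) + g * v"
    using uv(3) by (simp add: mult.assoc flip: const_mult)
  then show ?thesis
    unfolding cong_mod_def using uv Polys_mult Polys_const by blast
qed

lemma cong_mod_const_mult:
  "u \<in> Polys N \<Longrightarrow> cong_mod N q g (a + const q * u) a"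
  unfolding cong_mod_def by (intro bexI[of _ u] bexI[of _ 0]) (auto intro: Polys_0)

text \<open>Every monomial of a multiple of \<open>quad m\<close> contains some
  \<open>X (m + i)\<close>. Coefficients of monomials free of these variables are therefore well
  defined modulo q on the quotient ring; this is how coefficients of values of D are read
  off.\<close>

lemma cong_mod_lookup:
  assumes "cong_mod N q (quad m) a b" "\<And>i. i < m \<Longrightarrow> Poly_Mapping.lookup t (m + i) = 0"
  shows "q dvd Poly_Mapping.lookup a t - Poly_Mapping.lookup b t"
proof -
  obtain u v where uv: "a - b = const q * u + quad m * v"
    using assms unfolding cong_mod_def by blast
  have "quad m * v = (\<Sum>i<m. X (m + i) ^ 1 * (X i * v))"
    by (simp add: quad_def sum_distrib_left sum_distrib_right mult_ac)
  then have "Poly_Mapping.lookup (quad m * v) t = 0"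
    by (simp only: lookup_sum) (intro sum.neutral ballI lookup_X_power_mult_eq_0, simp add: assms)
  then have "Poly_Mapping.lookup (a - b) t = q * Poly_Mapping.lookup u t"
    by (simp add: uv lookup_add lookup_const_mult)
  then show ?thesis by (simp add: lookup_minus)
qed

section \<open>Additive maps and differential operators on the quotient\<close>

lemma diffop_ord_additive: "diffop_ord N q g n D \<Longrightarrow> additive_on_quot N q g D"
  by (cases n) auto

lemma additive_on_quot_closed:
  "additive_on_quot N q g D \<Longrightarrow> a \<in> Polys N \<Longrightarrow> D a \<in> Polys N"
  by (simp add: additive_on_quot_def)

lemma additive_on_quot_0:
  assumes "additive_on_quot N q g D"
  shows "cong_mod N q g (D 0) 0"
proof -
  have "cong_mod N q g (D (0 + 0)) (D 0 + D 0)"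
    using assms Polys_0 unfolding additive_on_quot_def by blast
  then obtain u v where uv: "u \<in> Polys N" "v \<in> Polys N" "- D 0 = const q * u + g * v"
    by (auto simp: cong_mod_def)
  have "D 0 - 0 = const q * (- u) + g * (- v)"
    using arg_cong[OF uv(3), of uminus] by simp
  then show ?thesis
    using uv Polys_uminus unfolding cong_mod_def by blast
qed

lemma additive_on_quot_sum:
  assumes D: "additive_on_quot N q g D" and "finite I" "\<And>i. i \<in> I \<Longrightarrow> F i \<in> Polys N"
  shows "cong_mod N q g (D (sum F I)) (\<Sum>i\<in>I. D (F i))"
  using assms(2,3)
proof (induction I rule: finite_induct)
  case empty
  then show ?case using additive_on_quot_0[OF D] by simp
next
  case (insert i I)
  have "cong_mod N q g (D (F i + sum F I)) (D (F i) + D (sum F I))"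
    using D insert.prems unfolding additive_on_quot_def by (blast intro: Polys_sum)
  also have "cong_mod N q g (D (F i) + D (sum F I)) (D (F i) + (\<Sum>i\<in>I. D (F i)))"
    using insert by (intro cong_mod_add cong_mod_refl) auto
  finally show ?case using insert.hyps by simp
qed

lemma additive_on_quot_const_mult:
  assumes "additive_on_quot N q g D" "a \<in> Polys N"
  shows "cong_mod N q g (D (const (int n) * a)) (const (int n) * D a)"
  using additive_on_quot_sum[OF assms(1), of "{..<n}" "\<lambda>_. a"] assms(2)
  by (simp add: const_of_nat)

text \<open>For the induction step put s = r^(c^(n+1)). The commutator E = [D, s] has order at most n,
  so it commutes with s, whence [D, s^c] = c s^(c-1) E vanishes modulo c.\<close>

lemma diffop_ord_commutes_power:
  assumes "diffop_ord N q g n D" "int c dvd q" "0 < c" "r \<in> Polys N" "a \<in> Polys N"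
  shows "cong_mod N (int c) g (D (r ^ (c ^ Suc n) * a)) (r ^ (c ^ Suc n) * D a)"
  using assms
proof (induction n arbitrary: D r a)
  case 0
  then have "cong_mod N q g (D (r ^ c * a)) (r ^ c * D a)"
    by (simp add: Polys_power)
  then show ?case using 0 cong_mod_dvd by simp
next
  case (Suc n)
  let ?cong = "cong_mod N (int c) g"
  define s where "s = r ^ (c ^ Suc n)"
  define E where "E = (\<lambda>a. D (s * a) - s * D a)"
  have s: "s \<in> Polys N"
    unfolding s_def using Suc.prems Polys_power by blast
  have E: "diffop_ord N q g n E"
    unfolding E_def using Suc.prems s by simp
  have E_in: "E b \<in> Polys N" if "b \<in> Polys N" for b
    using E that by (auto intro: additive_on_quot_closed dest: diffop_ord_additive)
  have E_s: "?cong (E (s * b)) (s * E b)" if "b \<in> Polys N" for b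
    unfolding s_def using Suc.IH[OF E] Suc.prems that by blast
  have E_pow: "?cong (E (s ^ k * a)) (s ^ k * E a)" for k
  proof (induction k)
    case 0
    then show ?case by (simp add: cong_mod_refl)
  next
    case (Suc k)
    have "?cong (E (s * (s ^ k * a))) (s * E (s ^ k * a))"
      using \<open>a \<in> Polys N\<close> s by (intro E_s Polys_intros)
    also have "?cong (s * E (s ^ k * a)) (s * (s ^ k * E a))"
      using Suc s by (rule cong_mod_mult_left)
    finally show ?case by (simp add: mult.assoc)
  qed
  \<comment> \<open>A Leibniz rule for powers of s; for c = \<open>Suc k\<close> the numerical
    factor is the modulus itself.\<close>
  have D_pow: "?cong (D (s ^ Suc k * a)) (s ^ Suc k * D a + of_nat (Suc k) * (s ^ k * E a))" for k
  proof (induction k)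
    case 0
    then show ?case by (simp add: cong_mod_refl E_def)
  next
    case (Suc k)
    have "D (s * (s ^ Suc k * a)) = s * D (s ^ Suc k * a) + E (s ^ Suc k * a)"
      by (simp add: E_def)
    also have "?cong \<dots> (s * (s ^ Suc k * D a + of_nat (Suc k) * (s ^ k * E a)) + s ^ Suc k * E a)"
      using Suc s E_pow by (intro cong_mod_add cong_mod_mult_left)
    also have "s * (s ^ Suc k * D a + of_nat (Suc k) * (s ^ k * E a)) + s ^ Suc k * E a =
        s ^ Suc (Suc k) * D a + of_nat (Suc (Suc k)) * (s ^ Suc k * E a)"
      by (simp add: algebra_simps)
    finally show ?case by (simp add: mult.assoc)
  qed
  obtain k where k: "c = Suc k"
    using \<open>0 < c\<close> gr0_implies_Suc by blast
  have "?cong (D (s ^ c * a)) (s ^ c * D a + const (int c) * (s ^ k * E a))"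
    using D_pow[of k] by (simp only: const_of_nat k)
  also have "?cong \<dots> (s ^ c * D a)"
    using s E_in Suc.prems by (intro cong_mod_const_mult Polys_intros) auto
  also have "s ^ c = r ^ (c ^ Suc (Suc n))"
    by (simp add: s_def mult_ac flip: power_mult)
  finally show ?case .
qed

section \<open>Coefficients of powers of the quadric\<close>

text \<open>Subtraction of exponents truncates, so several s may satisfy s - a = t. For each of them
  other than t + a, some exponent of s is smaller than that of a, and the binomial coefficient there
  vanishes.\<close>

lemma lookup_hasse:
  "Poly_Mapping.lookup (hasse a P) t = Poly_Mapping.lookup P (t + a) *
     (\<Prod>i\<in>Poly_Mapping.keys a. int (Poly_Mapping.lookup (t + a) i choose Poly_Mapping.lookup a i))"
proof -
  let ?c = "\<lambda>s. \<Prod>i\<in>Poly_Mapping.keys a. int (Poly_Mapping.lookup s i choose Poly_Mapping.lookup a i)"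
  have c: "(Poly_Mapping.lookup P s * ?c s when s - a = t) =
      (if s = t + a then Poly_Mapping.lookup P s * ?c s else 0)" for s
  proof (cases "s - a = t")
    case st: True
    show ?thesis
    proof (cases "s = t + a")
      case True
      then show ?thesis by (simp only: add_diff_cancel_right' if_True when_simps refl)
    next
      case False
      then obtain i where "Poly_Mapping.lookup s i \<noteq> Poly_Mapping.lookup (s - a + a) i"
        using poly_mapping_eqI[of s "s - a + a"] st by blast
      then have "Poly_Mapping.lookup s i < Poly_Mapping.lookup a i"
        unfolding lookup_add lookup_minus by linarith
      then have "?c s = 0"
        by (intro prod_zero) (auto simp: in_keys_iff intro!: bexI[of _ i])
      then show ?thesis
        using False by (simp only: mult_zero_right if_False when_def if_cancel)
    qed
  next
    case False
    then have "s \<noteq> t + a" by auto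
    with False show ?thesis by (simp only: when_simps if_False)
  qed
  have "Poly_Mapping.lookup (hasse a P) t =
      (\<Sum>s\<in>Poly_Mapping.keys P. if s = t + a then Poly_Mapping.lookup P s * ?c s else 0)"
    by (simp only: hasse_def lookup_sum lookup_single c)
  then show ?thesis by (simp add: in_keys_iff)
qed

text \<open>The sum has the shape used in \<open>frob_trace\<close>, so the exponent vector (p-1,
  ..., p-1) there is an instance by folding.\<close>

definition mon :: "nat \<Rightarrow> (nat \<Rightarrow> nat) \<Rightarrow> nat \<Rightarrow>\<^sub>0 nat" where
  "mon N h = (\<Sum>i<N. Poly_Mapping.single i (h i))"

lemma lookup_mon: "Poly_Mapping.lookup (mon N h) j = (if j < N then h j else 0)"
  by (simp add: mon_def lookup_sum lookup_single when_def)

lemma keys_mon: "Poly_Mapping.keys (mon N h) = {i. i < N \<and> h i \<noteq> 0}"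
  by (auto simp: in_keys_iff lookup_mon split: if_splits)

text \<open>The exponent vector of the product of the (x_i y_i)^(\<alpha> i), where y_i is X (m + i).\<close>

definition pairmon :: "nat \<Rightarrow> (nat \<Rightarrow> nat) \<Rightarrow> nat \<Rightarrow>\<^sub>0 nat" where
  "pairmon m \<alpha> = mon (2 * m) (\<lambda>i. if i < m then \<alpha> i else \<alpha> (i - m))"

lemma lookup_pairmon:
  "Poly_Mapping.lookup (pairmon m \<alpha>) j =
     (if j < m then \<alpha> j else if j < 2 * m then \<alpha> (j - m) else 0)"
  by (simp add: pairmon_def lookup_mon)

text \<open>This supplies the recursion for the coefficients of powers of \<open>quad m\<close>, one
  factor x_i y_i at a time.\<close>

lemma lookup_pair_mult_pairmon:
  assumes "i < m"
  shows "Poly_Mapping.lookup (X i * X (m + i) * P) (pairmon m \<alpha>) =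
    (if \<alpha> i = 0 then 0 else Poly_Mapping.lookup P (pairmon m (\<alpha>(i := \<alpha> i - 1))))"
proof (cases "\<alpha> i = 0")
  case True
  then show ?thesis
    using lookup_X_power_mult_eq_0[of "pairmon m \<alpha>" i 1 "X (m + i) * P"] assms
    by (simp add: lookup_pairmon mult.assoc)
next
  case False
  let ?e = "Poly_Mapping.single i 1 + Poly_Mapping.single (m + i) 1"
  have "pairmon m \<alpha> = ?e + pairmon m (\<alpha>(i := \<alpha> i - 1))"
    by (rule poly_mapping_eqI)
      (use False assms in \<open>auto simp: lookup_add lookup_pairmon lookup_single when_def\<close>)
  moreover have "X i * X (m + i) = Poly_Mapping.single ?e 1"
    by (simp add: X_def mult_single)
  ultimately show ?thesis
    using False by (simp only: lookup_single_mult_add) simp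
qed

text \<open>Splitting off one factor \<open>quad m\<close>, its i-th summand contributes \<alpha> i
  * n! once the product of factorials is multiplied in, and the \<alpha> i add up to n + 1. Keeping
  the factorials on the left avoids division.\<close>

lemma multinomial_coefficient_quad:
  assumes "(\<Sum>i<m. \<alpha> i) = n"
  shows "Poly_Mapping.lookup (quad m ^ n) (pairmon m \<alpha>) * (\<Prod>i<m. fact (\<alpha> i)) = fact n"
  using assms
proof (induction n arbitrary: \<alpha>)
  case 0
  then have "pairmon m \<alpha> = 0"
    by (intro poly_mapping_eqI) (simp add: lookup_pairmon)
  then show ?case using 0 by simp
next
  case (Suc n)
  have step: "Poly_Mapping.lookup (X i * X (m + i) * quad m ^ n) (pairmon m \<alpha>) *
      (\<Prod>i<m. fact (\<alpha> i)) = int (\<alpha> i) * fact n" if i: "i < m" for i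
  proof (cases "\<alpha> i")
    case 0
    then show ?thesis using i by (simp add: lookup_pair_mult_pairmon)
  next
    case (Suc k)
    let ?\<beta> = "\<alpha>(i := k)"
    have "(\<Sum>j\<in>{..<m} - {i}. ?\<beta> j) = (\<Sum>j\<in>{..<m} - {i}. \<alpha> j)"
      by (rule sum.cong) auto
    then have "(\<Sum>j<m. ?\<beta> j) = n"
      using Suc.prems Suc i sum.remove[of "{..<m}" i \<alpha>] sum.remove[of "{..<m}" i ?\<beta>] by simp
    then have IH: "Poly_Mapping.lookup (quad m ^ n) (pairmon m ?\<beta>) * (\<Prod>j<m. fact (?\<beta> j)) = fact n"
      by (rule Suc.IH)
    have "(\<Prod>j\<in>{..<m} - {i}. fact (?\<beta> j)) = (\<Prod>j\<in>{..<m} - {i}. fact (\<alpha> j) :: int)"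
      by (rule prod.cong) auto
    then have "(\<Prod>j<m. fact (\<alpha> j)) = int (\<alpha> i) * (\<Prod>j<m. fact (?\<beta> j))"
      using Suc i prod.remove[of "{..<m}" i "\<lambda>j. fact (\<alpha> j) :: int"]
        prod.remove[of "{..<m}" i "\<lambda>j. fact (?\<beta> j) :: int"]
      by simp
    then show ?thesis
      using i Suc IH by (simp add: lookup_pair_mult_pairmon)
  qed
  have "quad m ^ Suc n = (\<Sum>i<m. X i * X (m + i) * quad m ^ n)"
    by (simp add: quad_def sum_distrib_right)
  then have "Poly_Mapping.lookup (quad m ^ Suc n) (pairmon m \<alpha>) * (\<Prod>i<m. fact (\<alpha> i)) =
      (\<Sum>i<m. Poly_Mapping.lookup (X i * X (m + i) * quad m ^ n) (pairmon m \<alpha>) *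
        (\<Prod>i<m. fact (\<alpha> i)))"
    by (simp only: lookup_sum sum_distrib_right)
  also have "\<dots> = (\<Sum>i<m. int (\<alpha> i) * fact n)"
    by (rule sum.cong) (simp_all add: step)
  also have "\<dots> = int (\<Sum>i<m. \<alpha> i) * fact n"
    by (simp add: sum_distrib_right)
  also have "\<dots> = fact (Suc n)"
    using Suc.prems by simp
  finally show ?case .
qed

text \<open>Induction on k by (k+1) C(Q-1, k+1) = (Q-1-k) C(Q-1, k): since p divides Q but not k+1,
  it does not divide Q - (k+1). The case k = p-1 makes the binomial factors of the Frobenius trace
  units modulo p.\<close>

lemma prime_not_dvd_choose_pred:
  fixes p Q k :: nat
  assumes p: "prime p" and "p dvd Q" "0 < Q" "k < p"
  shows "\<not> p dvd (Q - 1 choose k)"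
  using \<open>k < p\<close>
proof (induction k)
  case 0
  then show ?case using p by (auto simp: prime_nat_iff)
next
  case (Suc k)
  have "p \<le> Q" using assms dvd_imp_le by blast
  then have "Q = Q - 1 - k + Suc k" using Suc.prems by simp
  moreover have "\<not> p dvd Suc k"
    using Suc.prems nat_dvd_not_less by blast
  ultimately have "\<not> p dvd (Q - 1 - k)"
    using \<open>p dvd Q\<close> dvd_add_right_iff[of p "Q - 1 - k" "Suc k"] by auto
  then have "\<not> p dvd (Q - 1 - k) * (Q - 1 choose k)"
    using Suc p prime_dvd_mult_iff by auto
  also have "(Q - 1 - k) * (Q - 1 choose k) = Suc k * (Q - 1 choose Suc k)"
    by (simp only: binomial_absorb_comp binomial_absorption)
  finally have "\<not> p dvd Suc k * (Q - 1 choose Suc k)" .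
  then show ?case using dvd_mult by blast
qed

text \<open>Among 1, ..., 2p-1 the only multiple of p is p itself.\<close>

lemma prime_square_not_dvd_fact:
  assumes p: "prime p"
  shows "\<not> p ^ 2 dvd (fact (2 * p - 1) :: nat)"
proof
  assume *: "p ^ 2 dvd (fact (2 * p - 1) :: nat)"
  have p1: "1 < p" using p prime_gt_1_nat by blast
  have "fact (2 * p - 1) = (\<Prod>{1..2 * p - 1})"
    by (simp add: fact_prod)
  also have "{1..2 * p - 1} = insert p ({1..<p} \<union> {p<..<2 * p})"
    using p1 by auto
  also have "\<Prod>\<dots> = p * \<Prod>({1..<p} \<union> {p<..<2 * p})"
    by (rule prod.insert) auto
  finally have "p dvd \<Prod>({1..<p} \<union> {p<..<2 * p})"
    using * p1 by (simp add: power2_eq_square)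
  then obtain k where k: "k \<in> {1..<p} \<union> {p<..<2 * p}" "p dvd k"
    using p prime_dvd_prod_iff[of "{1..<p} \<union> {p<..<2 * p}" p "\<lambda>x. x"] by blast
  then obtain l where "k = p * l" by blast
  moreover have "l < 2"
  proof -
    have "p * l < p * 2" using k(1) p1 \<open>k = p * l\<close> by auto
    then show ?thesis by simp
  qed
  ultimately have "k = 0 \<or> k = p"
    by (auto simp: less_2_cases_iff)
  then show False
    using k(1) by auto
qed

section \<open>The Frobenius trace does not lift\<close>

text \<open>Allowing any multiple q of p^2 treats R/p^2R (q = p^2) and R (q = 0) at once.\<close>

lemma frob_trace_quad_not_liftable:
  fixes q :: int
  assumes m: "3 \<le> m" and p: "prime p" and q: "int p ^ 2 dvd q"
  shows "\<not> lifts_to (2 * m) p q (quad m) (frob_trace (2 * m) p (quad m))"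
proof
  let ?f = "quad m" and ?N = "2 * m" and ?p2 = "int (p ^ 2)"
  let ?z = "\<lambda>i. X i * X (m + i)"
  let ?lk = "Poly_Mapping.lookup"
  assume "lifts_to ?N p q ?f (frob_trace ?N p ?f)"
  then obtain D n where D: "diffop_ord ?N q ?f n D"
    and lift: "\<And>a. a \<in> Polys ?N \<Longrightarrow> cong_mod ?N (int p) ?f (D a) (frob_trace ?N p ?f a)"
    unfolding lifts_to_def is_diffop_def by blast
  have add: "additive_on_quot ?N q ?f D"
    using D by (rule diffop_ord_additive)
  have p1: "1 < p" using p prime_gt_1_nat by blast
  have q2: "?p2 dvd q" using q by simp
  \<comment> \<open>The exponent provided by \<open>diffop_ord_commutes_power\<close> for c = p^2
    and order n.\<close>
  define Q where "Q = (p ^ 2) ^ Suc n"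
  have Q: "p dvd Q" "0 < Q" using p1 by (simp_all add: Q_def)
  then have pQ: "p \<le> Q" by (simp add: dvd_imp_le)
  \<comment> \<open>The target exponents of the z_i in f^(2p-1). They must be at most p-1 and have
    sum 2p-1, which takes at least three indices; here m \<ge> 3 enters.\<close>
  define \<alpha> :: "nat \<Rightarrow> nat" where "\<alpha> = (\<lambda>i. if i = 0 then 1 else if i < 3 then p - 1 else 0)"
  define \<gamma> where "\<gamma> = (\<lambda>i. p - 1 - \<alpha> i)"
  \<comment> \<open>The exponent Q-p is below Q, which hides multiples of x_i^Q, and becomes Q-1
    after the shift by p-1 in the Frobenius trace.\<close>
  define t where "t = mon ?N (\<lambda>i. if i < m then Q - p else 0)"
  define \<mu> where "\<mu> = t + pairmon m \<gamma>"
  define M :: mpoly where "M = Poly_Mapping.single \<mu> 1"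
  define e where "e = mon ?N (\<lambda>_. p - 1)"
  have t_0: "?lk t (m + i) = 0" for i
    by (simp add: t_def lookup_mon)
  \<comment> \<open>Since \<alpha> i \<le> p-1, the truncated difference \<gamma> is a true
    complement of \<alpha>. Thus M times the target monomial has exponent Q-1 in each x_i and p-1 in
    each y_i.\<close>
  have T: "t + e = \<mu> + pairmon m \<alpha>"
    by (rule poly_mapping_eqI)
      (use p1 in \<open>auto simp: \<mu>_def e_def \<gamma>_def \<alpha>_def lookup_add lookup_mon lookup_pairmon\<close>)
  have z: "?z i \<in> Polys ?N" if "i < m" for i
    using that by (intro Polys_intros) auto
  obtain W where W: "W \<in> Polys ?N" "?f ^ p = (\<Sum>i<m. ?z i ^ p) + const (int p) * W"
    using freshmans_dream_sum[OF p, of "{..<m}" ?z ?N] z unfolding quad_def by auto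
  have \<mu>_keys: "Poly_Mapping.keys \<mu> \<subseteq> {..<?N}"
    using keys_add[of t "pairmon m \<gamma>"] by (auto simp: \<mu>_def t_def pairmon_def keys_mon)
  then have M: "M \<in> Polys ?N"
    unfolding M_def by (rule Polys_single)

  have lookup_zp: "?p2 dvd ?lk (D (M * ?z i ^ p)) t" if i: "i < m" for i
  proof -
    \<comment> \<open>The cofactor of x_i^Q in M z_i^p: M supplies x_i^(Q-p), z_i^p supplies x_i^p,
      and y_i^p stays in r.\<close>
    define r :: mpoly where
      "r = Poly_Mapping.single (\<mu> - Poly_Mapping.single i (Q - p)) 1 * X (m + i) ^ p"
    have "\<mu> = Poly_Mapping.single i (Q - p) + (\<mu> - Poly_Mapping.single i (Q - p))"
      by (rule poly_mapping_eqI)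
        (use i in \<open>auto simp: \<mu>_def t_def lookup_add lookup_minus lookup_mon lookup_single when_def\<close>)
    then have "M = X i ^ (Q - p) * Poly_Mapping.single (\<mu> - Poly_Mapping.single i (Q - p)) 1"
      unfolding M_def X_power mult_single by simp
    moreover have "X i ^ Q = X i ^ (Q - p) * X i ^ p"
      using pQ by (simp flip: power_add)
    ultimately have Mz: "M * ?z i ^ p = X i ^ Q * r"
      by (simp add: r_def power_mult_distrib mult_ac)
    have "Poly_Mapping.keys (\<mu> - Poly_Mapping.single i (Q - p)) \<subseteq> Poly_Mapping.keys \<mu>"
      by (auto simp: in_keys_iff lookup_minus)
    with \<mu>_keys i have "r \<in> Polys ?N"
      unfolding r_def by (intro Polys_mult Polys_single Polys_power Polys_X) auto
    then have "cong_mod ?N ?p2 ?f (D (M * ?z i ^ p)) (X i ^ Q * D r)"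
      unfolding Mz Q_def using D q2 p1 i
      by (intro diffop_ord_commutes_power) (auto intro: Polys_X)
    moreover have "?lk (X i ^ Q * D r) t = 0"
      using pQ p1 i by (intro lookup_X_power_mult_eq_0) (simp add: t_def lookup_mon)
    ultimately show ?thesis
      using cong_mod_lookup[of ?N ?p2 m _ _ t] t_0 by fastforce
  qed

  \<comment> \<open>M f^p already vanishes in the quotient ring.\<close>
  have "cong_mod ?N q ?f (D (M * ?f ^ p)) 0"
  proof -
    have "M * ?f ^ p - 0 = const q * 0 + ?f * (M * ?f ^ (p - 1))"
      using p1 by (simp add: mult_ac flip: power_Suc)
    then have "cong_mod ?N q ?f (M * ?f ^ p) 0"
      unfolding cong_mod_def using M Polys_quad Polys_0 Polys_mult Polys_power by blast
    then have "cong_mod ?N q ?f (D (M * ?f ^ p)) (D 0)"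
      using add M Polys_quad Polys_0 Polys_mult Polys_power unfolding additive_on_quot_def by blast
    then show ?thesis
      using additive_on_quot_0[OF add] cong_mod_trans by blast
  qed
  then have *: "q dvd ?lk (D (M * ?f ^ p)) t"
    using cong_mod_lookup[of ?N q m _ 0 t] t_0 by fastforce

  have Mf: "M * ?f ^ p = (\<Sum>i<m. M * ?z i ^ p) + const (int p) * (M * W)"
    unfolding W(2) by (simp add: algebra_simps sum_distrib_left)
  have "cong_mod ?N q ?f (D ((\<Sum>i<m. M * ?z i ^ p) + const (int p) * (M * W)))
      (D (\<Sum>i<m. M * ?z i ^ p) + D (const (int p) * (M * W)))"
    using add M z W(1) unfolding additive_on_quot_def
    by (auto intro!: Polys_sum Polys_mult Polys_const Polys_power Polys_X)
  also have "cong_mod ?N q ?f (D (\<Sum>i<m. M * ?z i ^ p) + D (const (int p) * (M * W)))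
      ((\<Sum>i<m. D (M * ?z i ^ p)) + const (int p) * D (M * W))"
    using M z W(1)
    by (intro cong_mod_add additive_on_quot_sum[OF add] additive_on_quot_const_mult[OF add])
      (auto intro: Polys_mult Polys_power)
  finally have "cong_mod ?N q ?f (D (M * ?f ^ p))
      ((\<Sum>i<m. D (M * ?z i ^ p)) + const (int p) * D (M * W))"
    by (simp only: Mf)
  then have "q dvd ?lk (D (M * ?f ^ p)) t -
      ?lk ((\<Sum>i<m. D (M * ?z i ^ p)) + const (int p) * D (M * W)) t"
    using t_0 by (intro cong_mod_lookup)
  with * have "q dvd ?lk ((\<Sum>i<m. D (M * ?z i ^ p)) + const (int p) * D (M * W)) t"
    using dvd_diff_right_iff by blast
  then have "?p2 dvd (\<Sum>i<m. ?lk (D (M * ?z i ^ p)) t) + int p * ?lk (D (M * W)) t"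
    using q2 dvd_trans by (auto simp: lookup_add lookup_sum lookup_const_mult)
  moreover have "?p2 dvd (\<Sum>i<m. ?lk (D (M * ?z i ^ p)) t)"
    using lookup_zp by (intro dvd_sum) auto
  ultimately have "?p2 dvd int p * ?lk (D (M * W)) t"
    using dvd_add_right_iff by blast
  \<comment> \<open>Cancelling one p leaves a statement modulo p, where D may be replaced by the
    Frobenius trace.\<close>
  then have "int p dvd ?lk (D (M * W)) t"
    using p1 by (simp add: power2_eq_square)
  moreover have "int p dvd ?lk (D (M * W)) t - ?lk (frob_trace ?N p ?f (M * W)) t"
    using lift[OF Polys_mult[OF M W(1)]] t_0 by (intro cong_mod_lookup)
  ultimately have "int p dvd ?lk (frob_trace ?N p ?f (M * W)) t"
    using dvd_diff_right_iff by blast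
  also have "?lk (frob_trace ?N p ?f (M * W)) t = ?lk (?f ^ (p - 1) * (M * W)) (t + e) *
      (\<Prod>i\<in>Poly_Mapping.keys e. int (?lk (t + e) i choose ?lk e i))"
    unfolding frob_trace_def mon_def[symmetric] e_def by (rule lookup_hasse)
  finally have "int p dvd ?lk (?f ^ (p - 1) * (M * W)) (t + e) *
      (\<Prod>i\<in>Poly_Mapping.keys e. int (?lk (t + e) i choose ?lk e i))" .
  moreover have "\<not> int p dvd (\<Prod>i\<in>Poly_Mapping.keys e. int (?lk (t + e) i choose ?lk e i))"
  proof -
    have "\<not> p dvd (?lk (t + e) i choose ?lk e i)" if "i \<in> Poly_Mapping.keys e" for i
    proof -
      have "?lk e i = p - 1" "?lk (t + e) i = Q - 1 \<or> ?lk (t + e) i = p - 1"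
        using that pQ p1 by (auto simp: e_def t_def keys_mon lookup_mon lookup_add)
      then show ?thesis
        using prime_not_dvd_choose_pred[OF p, of Q "p - 1"] Q p1 by auto
    qed
    then show ?thesis
      using p by (simp add: prime_dvd_prod_iff)
  qed
  ultimately have "int p dvd ?lk (?f ^ (p - 1) * (M * W)) (t + e)"
    using p prime_dvd_mult_iff[of "int p"] by auto
  then have "?p2 dvd int p * ?lk (?f ^ (p - 1) * (M * W)) (t + e)"
    by (simp add: power2_eq_square)
  also have "int p * ?lk (?f ^ (p - 1) * (M * W)) (t + e) = ?lk (?f ^ (2 * p - 1)) (pairmon m \<alpha>)"
  proof -
    \<comment> \<open>After one factor f^p is expanded, the terms with z_i^p do not reach t + e,
      where y_i has exponent only p-1; what remains is p times the term with W.\<close>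
    have "M * ?f ^ (2 * p - 1) = ?f ^ (p - 1) * M * ?f ^ p"
    proof -
      have "2 * p - 1 = (p - 1) + p" using p1 by simp
      then show ?thesis by (simp only: power_add mult_ac)
    qed
    also have "\<dots> = (\<Sum>i<m. X (m + i) ^ p * (?f ^ (p - 1) * M * X i ^ p)) +
        const (int p) * (?f ^ (p - 1) * (M * W))"
      unfolding W(2) by (simp add: algebra_simps sum_distrib_left power_mult_distrib)
    finally have "?lk (M * ?f ^ (2 * p - 1)) (t + e) =
        (\<Sum>i<m. ?lk (X (m + i) ^ p * (?f ^ (p - 1) * M * X i ^ p)) (t + e)) +
        int p * ?lk (?f ^ (p - 1) * (M * W)) (t + e)"
      by (simp only: lookup_add lookup_sum lookup_const_mult)
    moreover have "?lk (X (m + i) ^ p * (?f ^ (p - 1) * M * X i ^ p)) (t + e) = 0" if "i < m" for i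
      using that p1 by (intro lookup_X_power_mult_eq_0) (simp add: t_def e_def lookup_add lookup_mon)
    moreover have "?lk (M * ?f ^ (2 * p - 1)) (t + e) = ?lk (?f ^ (2 * p - 1)) (pairmon m \<alpha>)"
      unfolding T M_def lookup_single_mult_add by simp
    ultimately show ?thesis by simp
  qed
  finally have "?p2 dvd ?lk (?f ^ (2 * p - 1)) (pairmon m \<alpha>)" .
  moreover have "(\<Sum>i<m. \<alpha> i) = 2 * p - 1"
  proof -
    have "(\<Sum>i<m. \<alpha> i) = (\<Sum>i<3. \<alpha> i)"
      using m by (intro sum.mono_neutral_right) (auto simp: \<alpha>_def)
    then show ?thesis
      using p1 by (simp add: \<alpha>_def eval_nat_numeral)
  qed
  \<comment> \<open>Divisibility by p^2 survives multiplication by the factorials of the \<alpha> i,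
    which turns the coefficient into (2p-1)!.\<close>
  ultimately have "?p2 dvd int (fact (2 * p - 1))"
    using multinomial_coefficient_quad[of \<alpha> m "2 * p - 1"] by (metis dvd_mult2 of_nat_fact)
  then show False
    using prime_square_not_dvd_fact[OF p] by (simp only: int_dvd_int_iff)
qed

theorem theorem6p1:
  fixes m p :: nat
  assumes "m \<ge> 3" and "prime p"
  shows "\<not> lifts_to (2 * m) p (int p ^ 2) (quad m) (frob_trace (2 * m) p (quad m))
       \<and> \<not> lifts_to (2 * m) p 0 (quad m) (frob_trace (2 * m) p (quad m))"
  using frob_trace_quad_not_liftable[OF assms] by simp

end
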